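(* The maximum local dimension of a poset on $n$ points is $\Theta(n/\log n)$. That is, there exist constants $c_1,c_2>0$ and an integer $N$ such that for every integer $n\ge N$, $$c_1\frac{n}{\log n}\ \le\ \max\{\operatorname{ldim}(\mathcal{P}) : \mathcal{P}\text{ is a poset with exactly } n \text{ elements}\}\ \le\ c_2\frac{n}{\log n}.$$
   Context: Posets are finite and nonempty. A partial linear extension (ple) of a poset $\mathcal{P}=(P,\le)$ is a linear extension of a (nonempty) subposet of $\mathcal{P}$, i.e. a linear order on a nonempty subset $S\subseteq P$ that extends the order induced by $\mathcal{P}$ on $S$. A local realizer of $\mathcal{P}$ is a non-empty family $\mathcal{L}$ of ple's of $\mathcal{P}$ such that (i) if $x<y$ in $\mathcal{P}$, then some $L\in\mathcal{L}$ contains $x,y$ with $x<y$ in $L$; (ii) if $x$ and $y$ are incomparable in $\mathcal{P}$, then there are $L,L'\in\mathcal{L}$ with $x<y$ in $L$ and $x>y$ in $L'$. For $x\in P$, the frequency $\mu(x,\mathcal{L})$ is the number of ple's in $\mathcal{L}$ containing $x$, and $\mu(\mathcal{L})=\max_{x\in P}\mu(x,\mathcal{L})$. The local dimension is $\operatorname{ldim}(\mathcal{P})=\min_{\mathcal{L}}\mu(\mathcal{L})$, the minimum over all local realizers $\mathcal{L}$ of $\mathcal{P}$. *)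

theory Defs
  imports Complex_Main
begin

definition poset :: "'a set \<Rightarrow> 'a rel \<Rightarrow> bool" where
  "poset P r \<longleftrightarrow> finite P \<and> P \<noteq> {} \<and> partial_order_on P r"

text \<open>
  All orders are reflexive relations.  Hence the support \<open>S\<close> of a partial linear extension \<open>L\<close>
  is determined by \<open>L\<close>, namely \<open>S = Field L\<close>, and ``\<open>L\<close> contains \<open>x\<close>'' reads \<open>x \<in> Field L\<close>.
\<close>

definition ple :: "'a set \<Rightarrow> 'a rel \<Rightarrow> 'a rel \<Rightarrow> bool" where
  "ple P r L \<longleftrightarrow> (\<exists>S. S \<noteq> {} \<and> S \<subseteq> P \<and> linear_order_on S L \<and> r \<inter> S \<times> S \<subseteq> L)"

text \<open>
  A family of partial linear extensions is a set.  Allowing repeated members would only increase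
  frequencies, so it would not change the local dimension.
\<close>

definition local_realizer :: "'a set \<Rightarrow> 'a rel \<Rightarrow> 'a rel set \<Rightarrow> bool" where
  "local_realizer P r \<L> \<longleftrightarrow>
     \<L> \<noteq> {} \<and>
     (\<forall>L\<in>\<L>. ple P r L) \<and>
     (\<forall>x\<in>P. \<forall>y\<in>P. x \<noteq> y \<and> (x, y) \<in> r \<longrightarrow> (\<exists>L\<in>\<L>. (x, y) \<in> L)) \<and>
     (\<forall>x\<in>P. \<forall>y\<in>P. (x, y) \<notin> r \<and> (y, x) \<notin> r \<longrightarrow>
        (\<exists>L\<in>\<L>. (x, y) \<in> L) \<and> (\<exists>L'\<in>\<L>. (y, x) \<in> L'))"

definition frequency :: "'a \<Rightarrow> 'a rel set \<Rightarrow> nat" where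
  "frequency x \<L> = card {L \<in> \<L>. x \<in> Field L}"

definition max_frequency :: "'a set \<Rightarrow> 'a rel set \<Rightarrow> nat" where
  "max_frequency P \<L> = Max ((\<lambda>x. frequency x \<L>) ` P)"

definition ldim :: "'a set \<Rightarrow> 'a rel \<Rightarrow> nat" where
  "ldim P r = Min {max_frequency P \<L> | \<L>. local_realizer P r \<L>}"

text \<open>
  Every finite poset is isomorphic to one whose points are natural numbers, and isomorphic posets
  have the same local dimension (\<open>ldim_iso\<close> below).  So \<open>max_ldim n\<close> is the maximum over all
  posets with exactly \<open>n\<close> points, of any type (\<open>max_ldim_ge\<close>, \<open>max_ldim_attained\<close>).
\<close>

definition max_ldim :: "nat \<Rightarrow> nat" where
  "max_ldim n = Max {ldim P r | (P :: nat set) r. poset P r \<and> card P = n}"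


lemma ple_subset: "ple P r L \<Longrightarrow> L \<subseteq> P \<times> P"
  unfolding ple_def order_on_defs by blast

lemma local_realizer_subset: "local_realizer P r \<L> \<Longrightarrow> \<L> \<subseteq> Pow (P \<times> P)"
  unfolding local_realizer_def using ple_subset by blast

lemma finite_local_realizers:
  assumes "poset P r"
  shows "finite {\<L>. local_realizer P r \<L>}"
proof (rule finite_subset)
  show "{\<L>. local_realizer P r \<L>} \<subseteq> Pow (Pow (P \<times> P))"
    using local_realizer_subset by blast
  show "finite (Pow (Pow (P \<times> P)))"
    using assms by (simp add: poset_def)
qed

lemma ple_pair:
  assumes "poset P r" "x \<in> P" "y \<in> P" "(y, x) \<in> r \<longrightarrow> x = y"
  shows "ple P r {(x, x), (y, y), (x, y)}"
  unfolding ple_def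
proof (intro exI conjI)
  show "linear_order_on {x, y} {(x, x), (y, y), (x, y)}"
    unfolding order_on_defs
    by (auto simp: refl_on_def total_on_def intro!: transI antisymI)
  show "r \<inter> {x, y} \<times> {x, y} \<subseteq> {(x, x), (y, y), (x, y)}"
    using assms(4) by auto
qed (use assms in auto)

lemma local_realizer_exists:
  assumes "poset P r"
  shows "local_realizer P r {L. ple P r L}"
proof -
  have anti: "(x, y) \<in> r \<Longrightarrow> (y, x) \<in> r \<Longrightarrow> x = y" for x y
    using assms unfolding poset_def order_on_defs by (blast dest: antisymD)
  have pair: "\<exists>L\<in>{L. ple P r L}. (x, y) \<in> L" if "x \<in> P" "y \<in> P" "(y, x) \<in> r \<longrightarrow> x = y" for x y
  proof
    show "{(x, x), (y, y), (x, y)} \<in> {L. ple P r L}"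
      using ple_pair[OF assms that] by simp
  qed simp
  obtain x where "x \<in> P" using assms by (auto simp: poset_def)
  then have "{L. ple P r L} \<noteq> {}" using pair[of x x] by blast
  then show ?thesis
    unfolding local_realizer_def
  proof (intro conjI ballI impI)
    fix x y assume "x \<in> P" "y \<in> P" "x \<noteq> y \<and> (x, y) \<in> r"
    then show "\<exists>L\<in>{L. ple P r L}. (x, y) \<in> L" using pair anti by metis
  qed (use pair in auto)
qed

lemma ldim_set_finite_nonempty:
  assumes "poset P r"
  shows "finite {max_frequency P \<L> | \<L>. local_realizer P r \<L>}"
    and "{max_frequency P \<L> | \<L>. local_realizer P r \<L>} \<noteq> {}"
  using finite_local_realizers[OF assms] local_realizer_exists[OF assms] by auto

lemma Field_map_prod: "Field (map_prod f f ` r) = f ` Field r"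
  unfolding Field_def by force

lemma mem_map_prod_iff:
  assumes "inj_on f P" "r \<subseteq> P \<times> P" "x \<in> P" "y \<in> P"
  shows "(f x, f y) \<in> map_prod f f ` r \<longleftrightarrow> (x, y) \<in> r"
proof
  assume "(f x, f y) \<in> map_prod f f ` r"
  then obtain a b where ab: "(a, b) \<in> r" "f x = f a" "f y = f b" by auto
  then have "x = a" "y = b" using assms by (blast dest: inj_onD)+
  with ab show "(x, y) \<in> r" by simp
qed force

lemma partial_order_on_map:
  assumes f: "inj_on f P" and r: "partial_order_on P r"
  shows "partial_order_on (f ` P) (map_prod f f ` r)"
proof -
  have sub: "r \<subseteq> P \<times> P" and refl: "refl_on P r" and tr: "trans r" and an: "antisym r"
    using r by (auto simp: order_on_defs)
  note iff = mem_map_prod_iff[OF f sub]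
  have sub': "map_prod f f ` r \<subseteq> f ` P \<times> f ` P" using sub by auto
  have "refl_on (f ` P) (map_prod f f ` r)"
    using refl iff unfolding refl_on_def by blast
  moreover have "trans (map_prod f f ` r)"
  proof (rule transI)
    fix a b c assume A: "(a, b) \<in> map_prod f f ` r" "(b, c) \<in> map_prod f f ` r"
    have "a \<in> f ` P" "b \<in> f ` P" "c \<in> f ` P"
      using subsetD[OF sub' A(1)] subsetD[OF sub' A(2)] by simp_all
    then obtain x y z where xyz: "a = f x" "b = f y" "c = f z" "x \<in> P" "y \<in> P" "z \<in> P"
      by (elim imageE)
    with A have "(x, y) \<in> r" "(y, z) \<in> r" using iff by simp_all
    then have "(x, z) \<in> r" by (rule transD[OF tr])
    with xyz show "(a, c) \<in> map_prod f f ` r" by (simp add: iff)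
  qed
  moreover have "antisym (map_prod f f ` r)"
  proof (rule antisymI)
    fix a b assume A: "(a, b) \<in> map_prod f f ` r" "(b, a) \<in> map_prod f f ` r"
    have "a \<in> f ` P" "b \<in> f ` P"
      using subsetD[OF sub' A(1)] by simp_all
    then obtain x y where xy: "a = f x" "b = f y" "x \<in> P" "y \<in> P"
      by (elim imageE)
    with A have "(x, y) \<in> r" "(y, x) \<in> r" using iff by simp_all
    then have "x = y" by (rule antisymD[OF an])
    with xy show "a = b" by simp
  qed
  ultimately show ?thesis using sub' by (simp add: order_on_defs)
qed

lemma poset_map:
  assumes "inj_on f P" "poset P r"
  shows "poset (f ` P) (map_prod f f ` r)"
  using assms partial_order_on_map by (auto simp: poset_def)

lemma ple_map:
  assumes f: "inj_on f P" and r: "r \<subseteq> P \<times> P" and L: "ple P r L"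
  shows "ple (f ` P) (map_prod f f ` r) (map_prod f f ` L)"
proof -
  obtain S where S: "S \<noteq> {}" "S \<subseteq> P" "linear_order_on S L" "r \<inter> S \<times> S \<subseteq> L"
    using L unfolding ple_def by blast
  have fS: "inj_on f S" using f S(2) by (rule inj_on_subset)
  have sub: "L \<subseteq> S \<times> S" and po: "partial_order_on S L" and tot: "total_on S L"
    using S(3) by (auto simp: order_on_defs)
  have "total_on (f ` S) (map_prod f f ` L)"
    using tot mem_map_prod_iff[OF fS sub] unfolding total_on_def by (metis imageE)
  then have lin: "linear_order_on (f ` S) (map_prod f f ` L)"
    using partial_order_on_map[OF fS po] by (simp add: linear_order_on_def)
  have "map_prod f f ` r \<inter> f ` S \<times> f ` S \<subseteq> map_prod f f ` L"
  proof
    fix p assume A: "p \<in> map_prod f f ` r \<inter> f ` S \<times> f ` S"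
    then obtain x y where "p = (f x, f y)" "x \<in> S" "y \<in> S"
      by (elim IntE SigmaE imageE) simp
    with A have xy: "p = (f x, f y)" "x \<in> S" "y \<in> S" "(f x, f y) \<in> map_prod f f ` r"
      by simp_all
    then have "(x, y) \<in> r" using mem_map_prod_iff[OF f r] S(2) by (simp add: subsetD)
    then show "p \<in> map_prod f f ` L" using xy S(4) by force
  qed
  with lin S(1,2) show ?thesis
    unfolding ple_def by (intro exI[of _ "f ` S"]) auto
qed

lemma local_realizer_map:
  assumes f: "inj_on f P" and r: "r \<subseteq> P \<times> P" and \<L>: "local_realizer P r \<L>"
  shows "local_realizer (f ` P) (map_prod f f ` r) ((`) (map_prod f f) ` \<L>)"
proof -
  note iff = mem_map_prod_iff[OF f r]
  have img: "\<exists>M\<in>(`) (map_prod f f) ` \<L>. (f x, f y) \<in> M" if "\<exists>L\<in>\<L>. (x, y) \<in> L" for x y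
    using that by force
  show ?thesis
    unfolding local_realizer_def
  proof (intro conjI)
    show "(`) (map_prod f f) ` \<L> \<noteq> {}"
      using \<L> by (simp add: local_realizer_def)
    show "\<forall>M\<in>(`) (map_prod f f) ` \<L>. ple (f ` P) (map_prod f f ` r) M"
      using \<L> ple_map[OF f r] by (auto simp: local_realizer_def)
    show "\<forall>a\<in>f ` P. \<forall>b\<in>f ` P. a \<noteq> b \<and> (a, b) \<in> map_prod f f ` r \<longrightarrow>
        (\<exists>M\<in>(`) (map_prod f f) ` \<L>. (a, b) \<in> M)"
    proof (intro ballI impI)
      fix a b assume A: "a \<in> f ` P" "b \<in> f ` P" "a \<noteq> b \<and> (a, b) \<in> map_prod f f ` r"
      then obtain x y where xy: "a = f x" "b = f y" "x \<in> P" "y \<in> P" by blast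
      then have "x \<noteq> y" "(x, y) \<in> r" using A(3) iff by auto
      then have "\<exists>L\<in>\<L>. (x, y) \<in> L"
        using \<L> xy unfolding local_realizer_def by blast
      then show "\<exists>M\<in>(`) (map_prod f f) ` \<L>. (a, b) \<in> M"
        unfolding xy by (rule img)
    qed
    show "\<forall>a\<in>f ` P. \<forall>b\<in>f ` P. (a, b) \<notin> map_prod f f ` r \<and> (b, a) \<notin> map_prod f f ` r \<longrightarrow>
        (\<exists>M\<in>(`) (map_prod f f) ` \<L>. (a, b) \<in> M) \<and>
        (\<exists>M\<in>(`) (map_prod f f) ` \<L>. (b, a) \<in> M)"
    proof (intro ballI impI)
      fix a b assume A: "a \<in> f ` P" "b \<in> f ` P"
        "(a, b) \<notin> map_prod f f ` r \<and> (b, a) \<notin> map_prod f f ` r"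
      then obtain x y where xy: "a = f x" "b = f y" "x \<in> P" "y \<in> P" by blast
      then have "(x, y) \<notin> r" "(y, x) \<notin> r" using A(3) iff by auto
      then have "(\<exists>L\<in>\<L>. (x, y) \<in> L) \<and> (\<exists>L\<in>\<L>. (y, x) \<in> L)"
        using \<L> xy unfolding local_realizer_def by blast
      then show "(\<exists>M\<in>(`) (map_prod f f) ` \<L>. (a, b) \<in> M) \<and>
          (\<exists>M\<in>(`) (map_prod f f) ` \<L>. (b, a) \<in> M)"
        unfolding xy using img by blast
    qed
  qed
qed

lemma max_frequency_map:
  assumes f: "inj_on f P" and \<L>: "\<L> \<subseteq> Pow (P \<times> P)"
  shows "max_frequency (f ` P) ((`) (map_prod f f) ` \<L>) = max_frequency P \<L>"
proof -
  have F: "Field L \<subseteq> P" if "L \<in> \<L>" for L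
    using \<L> that by (auto simp: Field_def)
  have "inj_on (map_prod f f) (P \<times> P)"
    using f by (auto simp: inj_on_def)
  then have inj: "inj_on ((`) (map_prod f f)) \<L>"
    using \<L> inj_on_image_Pow inj_on_subset by blast
  have "frequency (f x) ((`) (map_prod f f) ` \<L>) = frequency x \<L>" if x: "x \<in> P" for x
  proof -
    have "f x \<in> f ` Field L \<longleftrightarrow> x \<in> Field L" if "L \<in> \<L>" for L
      using inj_on_image_mem_iff[OF f x F[OF that]] .
    then have "{M \<in> (`) (map_prod f f) ` \<L>. f x \<in> Field M} =
        (`) (map_prod f f) ` {L \<in> \<L>. x \<in> Field L}"
      by (auto simp: Field_map_prod)
    then show ?thesis
      unfolding frequency_def by (simp add: card_image inj_on_subset[OF inj])
  qed
  then show ?thesis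
    unfolding max_frequency_def image_image by (simp cong: image_cong)
qed

lemma ldim_set_map_subset:
  assumes f: "inj_on f P" and r: "r \<subseteq> P \<times> P"
  shows "{max_frequency P \<L> | \<L>. local_realizer P r \<L>} \<subseteq>
    {max_frequency (f ` P) \<M> | \<M>. local_realizer (f ` P) (map_prod f f ` r) \<M>}"
  using max_frequency_map[OF f local_realizer_subset] local_realizer_map[OF f r]
  by (smt (verit, best) mem_Collect_eq subsetI)

lemma ldim_iso:
  assumes f: "inj_on f P" and r: "poset P r"
  shows "ldim (f ` P) (map_prod f f ` r) = ldim P r"
proof -
  let ?g = "inv_into P f"
  have sub: "r \<subseteq> P \<times> P" using r by (auto simp: poset_def order_on_defs)
  have sub': "map_prod f f ` r \<subseteq> f ` P \<times> f ` P" using sub by auto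
  have g: "inj_on ?g (f ` P)" by (simp add: inj_on_inv_into)
  have gP: "?g ` f ` P = P" using f by (simp add: inv_into_image_cancel)
  have "map_prod ?g ?g (map_prod f f p) = p" if "p \<in> r" for p
    using that sub f by (cases p) auto
  then have gr: "map_prod ?g ?g ` map_prod f f ` r = r"
    by (simp add: image_image)
  show ?thesis
    unfolding ldim_def
    by (rule arg_cong[where f = Min], rule subset_antisym)
      (use ldim_set_map_subset[OF f sub] ldim_set_map_subset[OF g sub'] in \<open>simp_all only: gP gr\<close>)
qed

lemma finite_ldim_values:
  "finite {ldim P r | (P :: 'a set) r. poset P r \<and> card P = n}" (is "finite ?V")
proof (rule finite_subset)
  let ?W = "ldim {..<n} ` Pow ({..<n} \<times> {..<n})"
  show "?V \<subseteq> ?W"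
  proof
    fix k assume "k \<in> ?V"
    then obtain P :: "'a set" and r where P: "poset P r" "card P = n" "k = ldim P r" by blast
    then obtain f where f: "bij_betw f P {..<n}"
      using ex_bij_betw_finite_nat[of P] by (auto simp: poset_def lessThan_atLeast0)
    then have inj: "inj_on f P" and im: "f ` P = {..<n}" by (auto simp: bij_betw_def)
    have "map_prod f f ` r \<subseteq> {..<n} \<times> {..<n}"
      using poset_map[OF inj P(1)] unfolding im by (auto simp: poset_def order_on_defs)
    moreover have "k = ldim {..<n} (map_prod f f ` r)"
      using ldim_iso[OF inj P(1)] P(3) im by simp
    ultimately show "k \<in> ?W" by blast
  qed
qed simp

lemma max_ldim_ge:
  assumes "poset P r" "card P = n"
  shows "ldim P r \<le> max_ldim n"
proof -
  obtain f where f: "bij_betw f P {0..<n}"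
    using ex_bij_betw_finite_nat[of P] assms by (auto simp: poset_def)
  then have inj: "inj_on f P" by (simp add: bij_betw_def)
  have "poset (f ` P) (map_prod f f ` r)" "card (f ` P) = n"
    using poset_map[OF inj assms(1)] card_image[OF inj] assms(2) by auto
  then have "ldim (f ` P) (map_prod f f ` r) \<le> max_ldim n"
    unfolding max_ldim_def by (intro Max_ge finite_ldim_values) blast
  then show ?thesis by (simp add: ldim_iso[OF inj assms(1)])
qed

lemma max_ldim_attained:
  assumes "n \<ge> 1"
  shows "\<exists>(P :: nat set) r. poset P r \<and> card P = n \<and> ldim P r = max_ldim n"
proof -
  have "poset {..<n} (Id_on {..<n})"
    using assms by (auto simp: poset_def order_on_defs refl_on_def lessThan_empty_iff
        intro!: transI antisymI)
  then have "{ldim P r | (P :: nat set) r. poset P r \<and> card P = n} \<noteq> {}"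
    by (metis (mono_tags, lifting) card_lessThan empty_Collect_eq)
  from Max_in[OF finite_ldim_values this] show ?thesis
    unfolding max_ldim_def by (smt (verit, best) mem_Collect_eq)
qed

end

theory Submission
  imports Defs "HOL-Real_Asymp.Real_Asymp"
begin

text \<open>
  Upper bound (after Erdos and Pyber): if all elements of \<open>A\<close> are incomparable to all elements
  of \<open>B\<close>, then some partial linear extension puts \<open>A\<close> below \<open>B\<close> and another one puts \<open>B\<close>
  below \<open>A\<close>.  Cut the points into blocks of size \<open>k\<close>, about half the binary logarithm of
  \<open>n\<close>.  For each block and each subset \<open>S\<close> of it, apply this to \<open>S\<close> and the set of points
  whose incomparable elements in the block are exactly \<open>S\<close>.  A point is met at most
  \<open>2 ^ k\<close> times through subsets of its own block and once per block through the other side.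

  Lower bound: a poset is determined by any of its local realizers, and a local realizer of
  frequency at most \<open>k\<close> is described by at most \<open>n * k\<close> triples (point, extension, position).
  So for \<open>k \<le> n\<close> there are at most \<open>n ^ (5 * n * k)\<close> posets of local dimension at most \<open>k\<close> on \<open>n\<close> given
  points, whereas at least \<open>2 ^ ((n div 2) * (n - n div 2))\<close> of them have height at most two.
\<close>

section \<open>Ranks in finite orders, and access to the local dimension\<close>

text \<open>Used twice: on a finite poset as the main part of a key for a linear extension, and on a
  linear order as the position of a point, counted from 1.\<close>

definition down_rank :: "'a rel \<Rightarrow> 'a \<Rightarrow> nat" where
  "down_rank r x = card {z. (z, x) \<in> r}"

lemma finite_down_set: "finite r \<Longrightarrow> finite {z. (z, x) \<in> r}"
  by (rule finite_subset[of _ "fst ` r"]) force+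

lemma down_rank_mono:
  assumes "finite r" "trans r" "(x, y) \<in> r"
  shows "down_rank r x \<le> down_rank r y"
  unfolding down_rank_def
  by (rule card_mono[OF finite_down_set[OF assms(1)]]) (use assms(2,3) in \<open>auto dest: transD\<close>)

text \<open>The point \<open>y\<close> lies in its own down set, and antisymmetry keeps it out of
  the down set of \<open>x\<close>.\<close>

lemma down_rank_strict_mono:
  assumes "finite r" "trans r" "antisym r" "(x, y) \<in> r" "(y, y) \<in> r" "x \<noteq> y"
  shows "down_rank r x < down_rank r y"
  unfolding down_rank_def
proof (rule psubset_card_mono[OF finite_down_set[OF assms(1)]])
  have "(y, x) \<notin> r" using assms by (auto dest: antisymD)
  then show "{z. (z, x) \<in> r} \<subset> {z. (z, y) \<in> r}"
    using assms by (auto dest: transD)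
qed

text \<open>Positions determine a finite linear order, so storing them loses nothing. By totality,
  failure of \<open>(x, y) \<in> L\<close> would put \<open>y\<close> strictly below
  \<open>x\<close>, against the ranks.\<close>

lemma linear_order_down_rank_iff:
  assumes L: "linear_order_on S L" "finite L" and xy: "x \<in> S" "y \<in> S"
  shows "(x, y) \<in> L \<longleftrightarrow> down_rank L x \<le> down_rank L y"
proof
  have o: "trans L" "antisym L" "refl_on S L" "total_on S L"
    using L by (auto simp: order_on_defs)
  show "(x, y) \<in> L \<Longrightarrow> down_rank L x \<le> down_rank L y"
    using down_rank_mono[OF L(2) o(1)] .
  assume le: "down_rank L x \<le> down_rank L y"
  show "(x, y) \<in> L"
  proof (rule ccontr)
    assume n: "(x, y) \<notin> L"
    have refl: "(x, x) \<in> L" using o(3) xy(1) by (rule refl_onD)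
    with n have "x \<noteq> y" by auto
    then have "(y, x) \<in> L" using n o(4) xy by (auto simp: total_on_def)
    from down_rank_strict_mono[OF L(2) o(1,2) this refl] \<open>x \<noteq> y\<close> le show False by auto
  qed
qed

lemma poset_imp:
  assumes "poset P r"
  shows "finite P" "finite r" "r \<subseteq> P \<times> P" "trans r" "antisym r" "\<And>x. x \<in> P \<Longrightarrow> (x, x) \<in> r"
proof -
  show P: "finite P" "r \<subseteq> P \<times> P" "trans r" "antisym r"
    using assms by (auto simp: poset_def order_on_defs)
  then show "finite r" by (meson finite_SigmaI finite_subset)
  show "\<And>x. x \<in> P \<Longrightarrow> (x, x) \<in> r"
    using assms by (auto simp: poset_def order_on_defs refl_on_def)
qed

lemma ldim_le:
  assumes P: "poset P r" and \<L>: "local_realizer P r \<L>"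
    and le: "\<And>x. x \<in> P \<Longrightarrow> frequency x \<L> \<le> c"
  shows "ldim P r \<le> c"
proof -
  have "ldim P r \<le> max_frequency P \<L>"
    unfolding ldim_def using ldim_set_finite_nonempty[OF P] \<L> by (intro Min_le) auto
  also have "\<dots> \<le> c"
    unfolding max_frequency_def using P le by (subst Max_le_iff) (auto simp: poset_def)
  finally show ?thesis .
qed

lemma ldim_obtains:
  assumes P: "poset P r"
  obtains \<L> where "local_realizer P r \<L>" "\<And>x. x \<in> P \<Longrightarrow> frequency x \<L> \<le> ldim P r"
proof -
  have "ldim P r \<in> {max_frequency P \<L> | \<L>. local_realizer P r \<L>}"
    unfolding ldim_def using ldim_set_finite_nonempty[OF P] by (rule Min_in)
  then obtain \<L> where \<L>: "local_realizer P r \<L>" "ldim P r = max_frequency P \<L>" by auto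
  show ?thesis
  proof
    show "frequency x \<L> \<le> ldim P r" if "x \<in> P" for x
      unfolding \<L>(2) max_frequency_def using poset_imp(1)[OF P] that by (intro Max_ge) auto
  qed fact
qed

subsection \<open>The upper bound\<close>

definition key_order :: "'a set \<Rightarrow> ('a \<Rightarrow> nat) \<Rightarrow> 'a rel" where
  "key_order S g = {(x, y). x \<in> S \<and> y \<in> S \<and> g x \<le> g y}"

lemma Field_key_order [simp]: "Field (key_order S g) = S"
  by (auto simp: key_order_def Field_def)

lemma ple_key_order:
  assumes "S \<noteq> {}" "S \<subseteq> P" "inj_on g S"
    and "\<And>x y. x \<in> S \<Longrightarrow> y \<in> S \<Longrightarrow> (x, y) \<in> r \<Longrightarrow> g x \<le> g y"
  shows "ple P r (key_order S g)"
  unfolding ple_def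
proof (intro exI conjI)
  show "linear_order_on S (key_order S g)"
    using assms(3) unfolding order_on_defs
    by (auto simp: key_order_def refl_on_def total_on_def inj_on_def intro!: transI antisymI)
qed (use assms in \<open>auto simp: key_order_def\<close>)

text \<open>With \<open>K\<close> above all values of \<open>g\<close>, the shift lifts
  \<open>B\<close> over \<open>A\<close>, while each side keeps the order given by
  \<open>g\<close>.\<close>

definition stack_order :: "('a \<Rightarrow> nat) \<Rightarrow> nat \<Rightarrow> 'a set \<Rightarrow> 'a set \<Rightarrow> 'a rel" where
  "stack_order g K A B = key_order (A \<union> B) (\<lambda>x. if x \<in> A then g x else g x + K)"

text \<open>Unshifted keys are below \<open>K\<close> and shifted ones are not, so injectivity
  survives. A pair of \<open>r\<close> never crosses between \<open>A\<close> and \<open>B\<close>,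
  so both of its keys are shifted or neither is.\<close>

lemma ple_stack_order:
  assumes "A \<union> B \<noteq> {}" "A \<union> B \<subseteq> P" "inj_on g P"
    and K: "\<And>x. x \<in> P \<Longrightarrow> g x < K"
    and g: "\<And>x y. (x, y) \<in> r \<Longrightarrow> g x \<le> g y"
    and inc: "\<And>a b. a \<in> A \<Longrightarrow> b \<in> B \<Longrightarrow> (a, b) \<notin> r \<and> (b, a) \<notin> r"
  shows "ple P r (stack_order g K A B)"
  unfolding stack_order_def
proof (rule ple_key_order)
  show "inj_on (\<lambda>x. if x \<in> A then g x else g x + K) (A \<union> B)"
  proof (rule inj_onI)
    fix x y assume xy: "x \<in> A \<union> B" "y \<in> A \<union> B"
      and eq: "(if x \<in> A then g x else g x + K) = (if y \<in> A then g y else g y + K)"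
    have P: "x \<in> P" "y \<in> P" using xy assms(2) by auto
    then have "g x = g y"
      using eq K[of x] K[of y] by (auto split: if_splits)
    then show "x = y" using P assms(3) by (auto dest: inj_onD)
  qed
qed (use assms in auto)

lemma stack_order_mem:
  assumes "a \<in> A" "b \<in> B" "b \<notin> A" "g a < K"
  shows "(a, b) \<in> stack_order g K A B"
  using assms by (auto simp: stack_order_def key_order_def)

lemma Field_stack_order [simp]: "Field (stack_order g K A B) = A \<union> B"
  by (simp add: stack_order_def)

text \<open>Order lexicographically by rank and then by an arbitrary numbering \<open>e\<close>.
  Since \<open>e\<close> stays below \<open>card P\<close>, it breaks ties without disturbing a
  strict increase of rank.\<close>

lemma linear_extension_key:
  assumes P: "poset P r"
  obtains g :: "'a \<Rightarrow> nat" where "inj_on g P" "\<And>x y. (x, y) \<in> r \<Longrightarrow> g x \<le> g y"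
proof -
  note p = poset_imp[OF P]
  obtain e where e: "bij_betw e P {0..<card P}"
    using ex_bij_betw_finite_nat[OF p(1)] by auto
  then have lt: "e x < card P" if "x \<in> P" for x
    using that by (auto dest: bij_betwE)
  define g where "g x = down_rank r x * card P + e x" for x
  have emod: "g x mod card P = e x" if "x \<in> P" for x
    using lt[OF that] by (simp add: g_def)
  show ?thesis
  proof
    show "inj_on g P"
    proof (rule inj_onI)
      fix x y assume xy: "x \<in> P" "y \<in> P" "g x = g y"
      then have "e x = e y" using emod by metis
      then show "x = y" using e xy by (auto simp: bij_betw_def dest: inj_onD)
    qed
    show "g x \<le> g y" if xy: "(x, y) \<in> r" for x y
    proof (cases "x = y")
      case False
      have P: "x \<in> P" "y \<in> P" using xy p(3) by auto
      have "down_rank r x < down_rank r y"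
        by (rule down_rank_strict_mono[OF p(2,4,5) xy p(6)[OF P(2)] False])
      then have "(down_rank r x + 1) * card P \<le> down_rank r y * card P"
        by (intro mult_right_mono) auto
      then show ?thesis using lt[OF P(1)] by (simp add: g_def)
    qed simp
  qed
qed

section \<open>The block construction and its frequency\<close>

text \<open>In the bound, 1 counts one full linear extension, which settles all comparable pairs;
  the factor 2 counts \<open>up\<close> and \<open>down\<close>; \<open>2 ^ k\<close> counts subsets
  of the own block; \<open>card P div k + 1\<close> counts the blocks \<open>0..m\<close>.\<close>

lemma ex_local_realizer_low_frequency:
  assumes P: "poset P r" and k: "k > 0"
  shows "\<exists>\<L>. local_realizer P r \<L> \<and>
    (\<forall>x\<in>P. frequency x \<L> \<le> 1 + 2 * (2 ^ k + (card P div k + 1)))"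
proof -
  note p = poset_imp[OF P]
  obtain g where g: "inj_on g P" "\<And>x y. (x, y) \<in> r \<Longrightarrow> g x \<le> (g y :: nat)"
    using linear_extension_key[OF P] by metis
  obtain K where K: "\<And>x. x \<in> P \<Longrightarrow> g x < K"
    using p(1) finite_nat_set_iff_bounded[of "g ` P"] by auto
  obtain e where e: "bij_betw e P {0..<card P}"
    using ex_bij_betw_finite_nat[OF p(1)] by auto
  define m where "m = card P div k"
  define B where "B i = {x \<in> P. e x div k = i}" for i
  define N where "N i v = {b \<in> B i. (b, v) \<notin> r \<and> (v, b) \<notin> r}" for i v
  define V where "V i S = {v \<in> P. N i v = S}" for i S
  \<comment> \<open>Pairs with empty union are dropped because a partial linear extension has
    nonempty support.\<close>
  define J where "J = {(i, S). i \<le> m \<and> S \<subseteq> B i \<and> S \<union> V i S \<noteq> {}}"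
  define up where "up = (\<lambda>(i, S). stack_order g K S (V i S))"
  define down where "down = (\<lambda>(i, S). stack_order g K (V i S) S)"
  define \<L> where "\<L> = insert (key_order P g) (up ` J \<union> down ` J)"
  have e_le: "e x div k \<le> m" if "x \<in> P" for x
    using that e bij_betwE[OF e] unfolding m_def by (intro div_le_mono) auto
  have finB: "finite (B i)" and subB: "B i \<subseteq> P" for i
    using p(1) by (auto simp: B_def)
  have cardB: "card (B i) \<le> k" for i
  proof -
    have "inj_on e (B i)" using e by (auto simp: B_def bij_betw_def inj_on_def)
    moreover have "e ` B i \<subseteq> {i * k..<i * k + k}"
    proof (rule image_subsetI)
      fix x assume "x \<in> B i"
      then have "i = e x div k" by (simp add: B_def)
      moreover have "e x div k * k \<le> e x \<and> e x < e x div k * k + k"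
        using div_times_less_eq_dividend[of "e x" k] dividend_less_div_times[OF k, of "e x"]
        by linarith
      ultimately show "e x \<in> {i * k..<i * k + k}" by simp
    qed
    ultimately have "card (B i) \<le> card {i * k..<i * k + k}"
      by (intro card_inj_on_le) auto
    then show ?thesis by simp
  qed
  have inc: "(a, b) \<notin> r \<and> (b, a) \<notin> r" if "a \<in> S" "b \<in> V i S" for a b i S
    using that by (auto simp: V_def N_def)
  have ple_J: "ple P r (up j)" "ple P r (down j)" if j_in: "j \<in> J" for j
  proof -
    obtain i S where j: "j = (i, S)" "S \<subseteq> B i" "S \<union> V i S \<noteq> {}"
      using j_in unfolding J_def by blast
    have sub: "S \<union> V i S \<subseteq> P" using j(2) subB by (auto simp: V_def)
    show "ple P r (up j)"
      unfolding up_def j(1) prod.case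
      by (rule ple_stack_order[OF j(3) sub g(1) K g(2)]) (use inc in auto)
    show "ple P r (down j)"
      unfolding down_def j(1) prod.case
      by (rule ple_stack_order[OF _ _ g(1) K g(2)]) (use inc j(3) sub in auto)
  qed
  have ext: "ple P r (key_order P g)"
    by (rule ple_key_order) (use P g in \<open>auto simp: poset_def\<close>)
  \<comment> \<open>Use the block of \<open>x\<close> and the set of all its points incomparable to
    \<open>y\<close>: this set contains \<open>x\<close>, and \<open>y\<close> is on the other side
    by definition of \<open>V\<close>. Reflexivity of \<open>r\<close> keeps the two sides
    apart.\<close>
  have cover: "(x, y) \<in> up (e x div k, N (e x div k) y)"
      "(y, x) \<in> down (e x div k, N (e x div k) y)"
      "(e x div k, N (e x div k) y) \<in> J"
    if xy: "x \<in> P" "y \<in> P" "(x, y) \<notin> r" "(y, x) \<notin> r" for x y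
  proof -
    let ?i = "e x div k"
    have x: "x \<in> N ?i y" and y: "y \<in> V ?i (N ?i y)"
      using xy by (auto simp: N_def B_def V_def)
    have y': "y \<notin> N ?i y" using p(6)[OF xy(2)] by (auto simp: N_def)
    have x': "x \<notin> V ?i (N ?i y)" using inc[OF x, of x] p(6)[OF xy(1)] by auto
    show "(x, y) \<in> up (?i, N ?i y)"
      unfolding up_def prod.case by (rule stack_order_mem[where g = g, OF x y y' K[OF xy(1)]])
    show "(y, x) \<in> down (?i, N ?i y)"
      unfolding down_def prod.case by (rule stack_order_mem[where g = g, OF y x x' K[OF xy(2)]])
    show "(?i, N ?i y) \<in> J"
      using x e_le[OF xy(1)] by (auto simp: J_def N_def)
  qed
  have "local_realizer P r \<L>"
    unfolding local_realizer_def
  proof (intro conjI)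
    show "\<L> \<noteq> {}" by (simp add: \<L>_def)
    show "\<forall>L\<in>\<L>. ple P r L" using ple_J ext by (auto simp: \<L>_def)
    show "\<forall>x\<in>P. \<forall>y\<in>P. x \<noteq> y \<and> (x, y) \<in> r \<longrightarrow> (\<exists>L\<in>\<L>. (x, y) \<in> L)"
    proof (intro ballI impI)
      fix x y assume "x \<in> P" "y \<in> P" "x \<noteq> y \<and> (x, y) \<in> r"
      then have "(x, y) \<in> key_order P g" using g(2) by (auto simp: key_order_def)
      then show "\<exists>L\<in>\<L>. (x, y) \<in> L" by (auto simp: \<L>_def)
    qed
    show "\<forall>x\<in>P. \<forall>y\<in>P. (x, y) \<notin> r \<and> (y, x) \<notin> r \<longrightarrow>
        (\<exists>L\<in>\<L>. (x, y) \<in> L) \<and> (\<exists>L'\<in>\<L>. (y, x) \<in> L')"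
    proof (intro ballI impI)
      fix x y assume "x \<in> P" "y \<in> P" "(x, y) \<notin> r \<and> (y, x) \<notin> r"
      then show "(\<exists>L\<in>\<L>. (x, y) \<in> L) \<and> (\<exists>L'\<in>\<L>. (y, x) \<in> L')"
        using cover[of x y] unfolding \<L>_def by blast
    qed
  qed
  moreover have "frequency x \<L> \<le> 1 + 2 * (2 ^ k + (m + 1))" if x: "x \<in> P" for x
  proof -
    \<comment> \<open>All indices whose extensions can contain \<open>x\<close>: if
      \<open>x \<in> S\<close>, then \<open>i\<close> is the block of \<open>x\<close>; if
      \<open>x \<in> V i S\<close>, then \<open>S\<close> is forced to be
      \<open>N i x\<close>.\<close>
    define I where "I = Pair (e x div k) ` Pow (B (e x div k)) \<union> (\<lambda>i. (i, N i x)) ` {..m}"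
    have finI: "finite I" using finB by (simp add: I_def)
    have "card I \<le> card (Pow (B (e x div k))) + card {..m}"
      unfolding I_def
      by (intro order_trans[OF card_Un_le] add_mono card_image_le) (use finB in auto)
    also have "card (Pow (B (e x div k))) \<le> 2 ^ k"
      using cardB finB by (simp add: card_Pow power_increasing)
    finally have cardI: "card I \<le> 2 ^ k + (m + 1)" by simp
    have inI: "j \<in> I" if j_in: "j \<in> J" and x_in: "x \<in> Field (up j) \<or> x \<in> Field (down j)" for j
    proof -
      obtain i S where j: "j = (i, S)" "i \<le> m" "S \<subseteq> B i"
        using j_in unfolding J_def by blast
      have "x \<in> S \<or> x \<in> V i S" using x_in by (auto simp: j(1) up_def down_def)
      then show ?thesis
      proof
        assume "x \<in> S"
        then have "i = e x div k" using j(3) by (auto simp: B_def)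
        then show ?thesis using j(1,3) by (simp add: I_def)
      next
        assume "x \<in> V i S"
        then have "S = N i x" by (simp add: V_def)
        then show ?thesis using j(1,2) by (simp add: I_def)
      qed
    qed
    have "{L \<in> \<L>. x \<in> Field L} \<subseteq> insert (key_order P g) (up ` I \<union> down ` I)"
      unfolding \<L>_def using inI by blast
    then have "frequency x \<L> \<le> card (insert (key_order P g) (up ` I \<union> down ` I))"
      unfolding frequency_def by (intro card_mono) (use finI in auto)
    also have "\<dots> \<le> Suc (card (up ` I \<union> down ` I))"
      by (rule card_insert_le_m1) auto
    also have "\<dots> \<le> Suc (card (up ` I) + card (down ` I))"
      using card_Un_le by auto
    also have "\<dots> \<le> Suc (card I + card I)"
      using card_image_le[OF finI] by (meson Suc_le_mono add_mono)
    finally show ?thesis using cardI by simp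
  qed
  ultimately show ?thesis unfolding m_def by blast
qed

lemma max_ldim_le:
  assumes "n \<ge> 1" "k > 0"
  shows "max_ldim n \<le> 1 + 2 * (2 ^ k + (n div k + 1))"
proof -
  obtain P :: "nat set" and r where P: "poset P r" "card P = n" "ldim P r = max_ldim n"
    using max_ldim_attained[OF assms(1)] by auto
  show ?thesis
    using ex_local_realizer_low_frequency[OF P(1) assms(2)] ldim_le[OF P(1)] P(2,3) by metis
qed

text \<open>Taking \<open>k\<close> as the floor of half the binary logarithm balances the two
  terms: \<open>2 ^ k\<close> is at most \<open>sqrt n\<close>, while \<open>k\<close> is still at
  least \<open>ln n / 4\<close>.\<close>

lemma max_ldim_upper:
  assumes n: "n \<ge> 8"
  shows "real (max_ldim n) \<le> 3 + 2 * sqrt n + 8 * (n / ln n)"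
proof -
  define t where "t = log 2 n / 2"
  define k where "k = nat \<lfloor>t\<rfloor>"
  have "log 2 n \<ge> 2" using n by (subst le_log_iff) auto
  then have t1: "t \<ge> 1" by (simp add: t_def)
  then have k: "real k \<le> t" "real k \<ge> t / 2" "k > 0"
  proof -
    \<comment> \<open>Rounding down a number that is at least 1 costs at most a factor of 2.\<close>
    have "\<lfloor>t\<rfloor> \<ge> 1" using t1 by simp
    then show "real k \<le> t" "real k \<ge> t / 2" "k > 0"
      unfolding k_def by linarith+
  qed
  have "ln (real n) * ln 2 \<le> ln (real n) * 1"
    using n ln_le_minus_one[of 2] by (intro mult_left_mono) auto
  then have "ln n \<le> log 2 n" by (simp add: log_def field_simps)
  then have lnk: "real k \<ge> ln n / 4" using k(2) by (simp add: t_def)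
  have ln_pos: "ln (real n) > 0" using n by simp
  have "real (2 ^ k) = 2 powr k" by (simp add: powr_realpow)
  also have "\<dots> \<le> 2 powr (log 2 n / 2)" using k(1) by (simp add: t_def)
  also have "\<dots> = (2 powr log 2 n) powr (1 / 2)" by (simp only: powr_powr mult_1_right times_divide_eq_right)
  also have "\<dots> = sqrt n" using n by (simp add: powr_half_sqrt)
  finally have a: "real (2 ^ k) \<le> sqrt n" .
  have "real (n div k) \<le> n / k" by (rule of_nat_div_le_of_nat)
  also have "\<dots> \<le> n / (ln n / 4)"
    using lnk ln_pos by (intro divide_left_mono) auto
  finally have b: "real (n div k) \<le> 4 * (n / ln n)" by (simp add: mult.commute)
  have "real (max_ldim n) \<le> real (1 + 2 * (2 ^ k + (n div k + 1)))"
    using max_ldim_le[OF _ k(3), of n] n by (simp only: of_nat_le_iff)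
  also have "\<dots> = 3 + 2 * real (2 ^ k) + 2 * real (n div k)" by simp
  finally show ?thesis using a b by linarith
qed

subsection \<open>The lower bound\<close>

text \<open>List the elements of a set and pad with the extra letter \<open>None\<close> to length
  exactly \<open>q\<close>. The words of length \<open>q\<close> over \<open>card U + 1\<close>
  letters thus map onto these sets.\<close>

lemma card_bounded_subsets_le:
  assumes "finite U"
  shows "card {A. A \<subseteq> U \<and> card A \<le> q} \<le> (card U + 1) ^ q"
proof -
  let ?W = "insert None (Some ` U)"
  let ?X = "{xs. set xs \<subseteq> ?W \<and> length xs = q}"
  have fin: "finite ?W" using assms by simp
  have "{A. A \<subseteq> U \<and> card A \<le> q} \<subseteq> (\<lambda>xs. {a. Some a \<in> set xs}) ` ?X"
  proof
    fix A assume "A \<in> {A. A \<subseteq> U \<and> card A \<le> q}"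
    then have A: "A \<subseteq> U" "card A \<le> q" by auto
    then have "finite A" using assms finite_subset by blast
    then obtain xs where xs: "set xs = A" "distinct xs" using finite_distinct_list by auto
    let ?ys = "map Some xs @ replicate (q - card A) None"
    have "length ?ys = q" using A xs distinct_card[of xs] by auto
    moreover have "set ?ys \<subseteq> ?W" using A xs by auto
    moreover have "A = {a. Some a \<in> set ?ys}" using xs by auto
    ultimately show "A \<in> (\<lambda>xs. {a. Some a \<in> set xs}) ` ?X" by blast
  qed
  then have "card {A. A \<subseteq> U \<and> card A \<le> q} \<le> card ?X"
    by (rule surj_card_le[OF finite_lists_length_eq[OF fin]])
  also have "\<dots> = card ?W ^ q" by (rule card_lists_length_eq[OF fin])
  also have "card ?W = card U + 1" using assms by (simp add: card_image)
  finally show ?thesis .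
qed

text \<open>A triple \<open>(x, l, p)\<close> records that \<open>x\<close> has position
  \<open>p\<close> in the extension numbered \<open>l\<close>.\<close>

definition code_le :: "('a \<times> nat \<times> nat) set \<Rightarrow> 'a \<Rightarrow> 'a \<Rightarrow> bool" where
  "code_le C x y \<longleftrightarrow> (\<exists>l p q. (x, l, p) \<in> C \<and> (y, l, q) \<in> C \<and> p \<le> q)"

text \<open>A local realizer shows an incomparable pair in both directions and a strictly comparable
  pair in one only, so pairs seen both ways are discarded. The diagonal is symmetric and is
  therefore added separately.\<close>

definition decode :: "'a set \<Rightarrow> ('a \<times> nat \<times> nat) set \<Rightarrow> 'a rel" where
  "decode P C = {(x, y). x \<in> P \<and> y \<in> P \<and> (x = y \<or> code_le C x y \<and> \<not> code_le C y x)}"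

lemma poset_decode:
  assumes P: "poset P r" and k: "ldim P r \<le> k"
  shows "\<exists>C. C \<subseteq> P \<times> {..<card P * k} \<times> {..card P} \<and> card C \<le> card P * k \<and> decode P C = r"
proof -
  note p = poset_imp[OF P]
  obtain \<L> where \<L>: "local_realizer P r \<L>" and freq: "\<And>x. x \<in> P \<Longrightarrow> frequency x \<L> \<le> ldim P r"
    using ldim_obtains[OF P] by blast
  have sub: "\<L> \<subseteq> Pow (P \<times> P)" by (rule local_realizer_subset[OF \<L>])
  then have fin\<L>: "finite \<L>" using p(1) by (meson finite_Pow_iff finite_SigmaI finite_subset)
  have ple: "ple P r L" if "L \<in> \<L>" for L using that \<L> by (auto simp: local_realizer_def)
  have fld: "Field L \<subseteq> P" if "L \<in> \<L>" for L using that sub by (auto simp: Field_def)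
  have finL: "finite L" if "L \<in> \<L>" for L
    using that sub p(1) by (meson Pow_iff finite_SigmaI finite_subset subsetD)
  have lin: "linear_order_on (Field L) L" "Field L \<noteq> {}" "r \<inter> Field L \<times> Field L \<subseteq> L" if "L \<in> \<L>" for L
  proof -
    obtain S where S: "S \<noteq> {}" "linear_order_on S L" "r \<inter> S \<times> S \<subseteq> L"
      using ple[OF \<open>L \<in> \<L>\<close>] unfolding ple_def by metis
    have "Field L = S"
      using S(2) by (auto simp: order_on_defs refl_on_def Field_def)
    with S show "linear_order_on (Field L) L" "Field L \<noteq> {}" "r \<inter> Field L \<times> Field L \<subseteq> L" by auto
  qed
  \<comment> \<open>Incidences of points and extensions. Counted by points, there are at most
    \<open>k\<close> for each.\<close>
  define D where "D = (SIGMA x:P. {L \<in> \<L>. x \<in> Field L})"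
  have finD: "finite D" using p(1) fin\<L> by (simp add: D_def)
  have "card D = (\<Sum>x\<in>P. frequency x \<L>)"
    unfolding D_def frequency_def using p(1) fin\<L> by (subst card_SigmaI) auto
  also have "\<dots> \<le> (\<Sum>x\<in>P. k)" using freq k order_trans by (intro sum_mono) blast
  finally have cardD: "card D \<le> card P * k" by simp
  \<comment> \<open>Each extension has nonempty support and so occurs in an incidence; hence
    \<open>card P * k\<close> labels suffice.\<close>
  have "\<L> \<subseteq> snd ` D" using lin(2) fld unfolding D_def by force
  then have card\<L>: "card \<L> \<le> card P * k"
    using surj_card_le[OF finD] cardD by (meson order_trans)
  obtain i where i: "bij_betw i \<L> {0..<card \<L>}"
    using ex_bij_betw_finite_nat[OF fin\<L>] by auto
  then have i_inj: "L = M" if "i L = i M" "L \<in> \<L>" "M \<in> \<L>" for L M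
    using that by (auto simp: bij_betw_def dest: inj_onD)
  define C where "C = (\<lambda>(x, L). (x, i L, down_rank L x)) ` D"
  have rank_le: "down_rank L x \<le> card P" if "L \<in> \<L>" for L x
    unfolding down_rank_def using that sub by (intro card_mono p(1)) auto
  have C_sub: "C \<subseteq> P \<times> {..<card P * k} \<times> {..card P}"
  proof
    fix c assume "c \<in> C"
    then obtain x L where c: "c = (x, i L, down_rank L x)" "x \<in> P" "L \<in> \<L>"
      by (auto simp: C_def D_def)
    moreover have "i L < card P * k" using bij_betwE[OF i] c(3) card\<L> by fastforce
    ultimately show "c \<in> P \<times> {..<card P * k} \<times> {..card P}" using rank_le by simp
  qed
  have cardC: "card C \<le> card P * k"
    unfolding C_def using card_image_le[OF finD] cardD by (rule order_trans)
  have code: "code_le C x y \<longleftrightarrow> (\<exists>L\<in>\<L>. (x, y) \<in> L)" for x y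
  proof
    assume "code_le C x y"
    then obtain l p q where lpq: "(x, l, p) \<in> C" "(y, l, q) \<in> C" "p \<le> q"
      unfolding code_le_def by blast
    obtain L where "L \<in> \<L>" "x \<in> Field L" "l = i L" "p = down_rank L x"
      using lpq(1) by (auto simp: C_def D_def)
    moreover obtain M where "M \<in> \<L>" "y \<in> Field M" "l = i M" "q = down_rank M y"
      using lpq(2) by (auto simp: C_def D_def)
    ultimately have LM: "L \<in> \<L>" "M \<in> \<L>" "i L = i M" "x \<in> Field L" "y \<in> Field M"
        "down_rank L x \<le> down_rank M y"
      using lpq(3) by auto
    then have "M = L" using i_inj by auto
    with LM have "(x, y) \<in> L"
      using linear_order_down_rank_iff[OF lin(1) finL, of L x y] by auto
    with LM(1) show "\<exists>L\<in>\<L>. (x, y) \<in> L" by blast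
  next
    assume "\<exists>L\<in>\<L>. (x, y) \<in> L"
    then obtain L where L: "L \<in> \<L>" "(x, y) \<in> L" by blast
    then have xy: "x \<in> Field L" "y \<in> Field L" by (auto simp: Field_def)
    then have "down_rank L x \<le> down_rank L y"
      using linear_order_down_rank_iff[OF lin(1) finL, of L x y] L by auto
    moreover have "(x, i L, down_rank L x) \<in> C" "(y, i L, down_rank L y) \<in> C"
      using L xy fld[OF L(1)] unfolding C_def D_def by force+
    ultimately show "code_le C x y" unfolding code_le_def by blast
  qed
  \<comment> \<open>The last assumption excludes only \<open>y\<close> strictly below
    \<open>x\<close>, where no extension can contain \<open>(x, y)\<close>.\<close>
  have realized: "\<exists>L\<in>\<L>. (x, y) \<in> L"
    if "x \<in> P" "y \<in> P" "x \<noteq> y" "(y, x) \<notin> r \<or> (x, y) \<in> r" for x y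
    using \<L> that unfolding local_realizer_def by metis
  have no_rev: "(y, x) \<notin> L" if "(x, y) \<in> r" "x \<noteq> y" "L \<in> \<L>" for x y L
  proof
    assume yx: "(y, x) \<in> L"
    then have "(x, y) \<in> L" using lin(3)[OF that(3)] that(1) by (auto simp: Field_def)
    moreover have "antisym L" using lin(1)[OF that(3)] by (auto simp: order_on_defs)
    ultimately show False using yx that(2) by (auto dest: antisymD)
  qed
  have "(x, y) \<in> decode P C \<longleftrightarrow> (x, y) \<in> r" for x y
  proof (cases "x \<in> P \<and> y \<in> P \<and> x \<noteq> y")
    case True
    have "(x, y) \<in> r \<Longrightarrow> \<exists>L\<in>\<L>. (x, y) \<in> L"
      and "(x, y) \<notin> r \<Longrightarrow> (y, x) \<notin> r \<Longrightarrow> \<exists>L\<in>\<L>. (y, x) \<in> L"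
      and "(y, x) \<in> r \<Longrightarrow> \<exists>L\<in>\<L>. (y, x) \<in> L"
      using True realized by auto
    then show ?thesis
      using True no_rev unfolding decode_def code by blast
  next
    case False
    then show ?thesis using p(3,6) by (auto simp: decode_def)
  qed
  then have "decode P C = r" by auto
  with C_sub cardC show ?thesis by blast
qed

lemma card_posets_le:
  assumes P: "finite P" and k: "\<And>r. poset P r \<Longrightarrow> ldim P r \<le> k"
  shows "card {r. poset P r} \<le> (card P * (card P * k * (card P + 1)) + 1) ^ (card P * k)"
proof -
  let ?U = "P \<times> {..<card P * k} \<times> {..card P}"
  let ?\<C> = "{C. C \<subseteq> ?U \<and> card C \<le> card P * k}"
  have fin: "finite ?U" using P by simp
  have "{r. poset P r} \<subseteq> decode P ` ?\<C>"
    using poset_decode[OF _ k] by blast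
  then have "card {r. poset P r} \<le> card ?\<C>"
    by (rule surj_card_le[rotated]) (rule finite_subset[of _ "Pow ?U"], use fin in auto)
  also have "\<dots> \<le> (card ?U + 1) ^ (card P * k)"
    by (rule card_bounded_subsets_le[OF fin])
  also have "card ?U = card P * (card P * k * (card P + 1))"
    by (simp add: card_cartesian_product)
  finally show ?thesis .
qed

section \<open>Many posets of height at most two, and the comparison of counts\<close>

text \<open>Every relation \<open>E\<close> from the lower half of the numbers to the upper half
  gives a poset: no two pairs of \<open>E\<close> can be chained, so transitivity and antisymmetry
  are immediate. Removing the diagonal recovers \<open>E\<close>.\<close>

lemma card_posets_ge:
  assumes "n \<ge> 1"
  shows "2 ^ ((n div 2) * (n - n div 2)) \<le> card {r. poset {..<n} r}"
proof -
  let ?m = "n div 2"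
  let ?X = "{..<?m} \<times> {?m..<n}"
  let ?f = "\<lambda>E. Id_on {..<n} \<union> E"
  have m: "?m \<le> n" by simp
  have "?f ` Pow ?X \<subseteq> {r. poset {..<n} r}"
  proof (rule image_subsetI)
    fix E assume "E \<in> Pow ?X"
    then have E: "E \<subseteq> ?X" by simp
    then have *: "x < ?m \<and> ?m \<le> y" if "(x, y) \<in> E" for x y using that by auto
    have no_chain: "False" if "(x, y) \<in> E" "(y, z) \<in> E" for x y z
      using *[OF that(1)] *[OF that(2)] by simp
    have "trans (?f E)" by (intro transI) (auto dest: no_chain)
    moreover have "antisym (?f E)" by (intro antisymI) (auto dest: no_chain)
    moreover have "refl_on {..<n} (?f E)" by (auto simp: refl_on_def)
    moreover have "?f E \<subseteq> {..<n} \<times> {..<n}" using E m by auto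
    ultimately show "?f E \<in> {r. poset {..<n} r}"
      using assms by (auto simp: poset_def order_on_defs lessThan_empty_iff)
  qed
  moreover have "inj_on ?f (Pow ?X)"
  proof (rule inj_on_inverseI)
    fix E assume "E \<in> Pow ?X"
    then show "?f E - Id_on {..<n} = E" by auto
  qed
  moreover have "finite {r. poset {..<n} r}"
    by (rule finite_subset[of _ "Pow ({..<n} \<times> {..<n})"]) (auto simp: poset_def order_on_defs)
  ultimately have "card (Pow ?X) \<le> card {r. poset {..<n} r}"
    by (intro card_inj_on_le)
  then show ?thesis by (simp add: card_Pow card_cartesian_product)
qed

text \<open>Apply the counting bound with \<open>k = max_ldim n\<close>, which covers all posets on
  \<open>n\<close> points. The constant 50 is 5 from the bound \<open>n ^ 5\<close>, times 5 from
  estimating the number of cross pairs, times 2 from \<open>ln 2 \<ge> 1/2\<close>.\<close>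

lemma max_ldim_lower:
  assumes n: "n \<ge> 3"
  shows "real n / ln n \<le> 50 * real (max_ldim n)"
proof (cases "max_ldim n \<le> n")
  case False
  \<comment> \<open>Since \<open>exp 1 \<le> 3 \<le> n\<close>, the logarithm is at least 1, so
    \<open>n / ln n\<close> does not exceed \<open>n\<close>.\<close>
  have "ln (real n) \<ge> ln (exp 1)" using n exp_le by (subst ln_le_cancel_iff) auto
  then have "real n / ln n \<le> n" using n by (simp add: field_simps mult_left_le)
  also have "\<dots> \<le> 50 * real (max_ldim n)" using False by linarith
  finally show ?thesis .
next
  case True
  define k where "k = max_ldim n"
  have ln: "ln (real n) > 0" using n by simp
  have "n * (n * k * (n + 1)) + 1 \<le> n * (n * n * (n + 1)) + 1"
    using True unfolding k_def by (intro add_right_mono mult_right_mono mult_left_mono) auto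
  also have "\<dots> \<le> n * n * (n * (n + 2))"
  proof -
    have "1 \<le> n * n * n" using n by simp
    then show ?thesis by (simp add: algebra_simps)
  qed
  also have "\<dots> \<le> n * n * (n * (n * n))"
    using n by (intro mult_left_mono) (auto intro: order_trans[of _ "n * 2"])
  also have "\<dots> = n ^ 5" by (simp add: numeral_eq_Suc)
  finally have U: "n * (n * k * (n + 1)) + 1 \<le> n ^ 5" .
  have "2 ^ ((n div 2) * (n - n div 2)) \<le> card {r. poset {..<n} r}"
    using n by (intro card_posets_ge) simp
  also have "\<dots> \<le> (n * (n * k * (n + 1)) + 1) ^ (n * k)"
    using card_posets_le[of "{..<n}" k] max_ldim_ge[of "{..<n}" _ n] by (simp add: k_def)
  also have "\<dots> \<le> (n ^ 5) ^ (n * k)" by (rule power_mono[OF U]) simp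
  finally have "real (2 ^ ((n div 2) * (n - n div 2))) \<le> real ((n ^ 5) ^ (n * k))"
    by (simp only: of_nat_le_iff)
  then have "ln (real (2 ^ ((n div 2) * (n - n div 2)))) \<le> ln (real ((n ^ 5) ^ (n * k)))"
    using n by (subst ln_le_cancel_iff) auto
  then have l: "real ((n div 2) * (n - n div 2)) * ln 2 \<le> real (n * k) * (5 * ln n)"
    using n by (simp add: ln_realpow)
  \<comment> \<open>The product is about a quarter of \<open>n * n\<close>; the factor 5 instead of
    4 absorbs the loss for odd \<open>n\<close>.\<close>
  have "n * n \<le> 5 * ((n div 2) * (n - n div 2))"
  proof (cases "even n")
    case True
    then obtain a where "n = 2 * a" by blast
    then show ?thesis by simp
  next
    case False
    then obtain a where a: "n = 2 * a + 1" by (rule oddE)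
    with n have "1 * 1 \<le> a * a" by (intro mult_mono) auto
    with a n show ?thesis by (simp add: algebra_simps)
  qed
  then have "real n * real n \<le> 5 * real ((n div 2) * (n - n div 2))"
    by (metis of_nat_le_iff of_nat_mult of_nat_numeral)
  \<comment> \<open>From \<open>ln (1/2) \<le> 1/2 - 1\<close> one gets
    \<open>ln 2 \<ge> 1/2\<close>.\<close>
  moreover have "real ((n div 2) * (n - n div 2)) * (1/2) \<le> real ((n div 2) * (n - n div 2)) * ln 2"
    using ln_le_minus_one[of "1 / 2"] by (intro mult_left_mono) (auto simp: ln_div)
  ultimately have "real n * real n \<le> real n * (50 * real k * ln n)"
    using l by simp
  then have "real n \<le> 50 * real k * ln n" using n by simp
  then show ?thesis using ln by (simp add: k_def field_simps)
qed

theorem theorem2: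
  shows "\<exists>(c\<^sub>1::real) (c\<^sub>2::real) (N::nat). c\<^sub>1 > 0 \<and> c\<^sub>2 > 0 \<and>
    (\<forall>n\<ge>N. c\<^sub>1 * (real n / ln (real n)) \<le> real (max_ldim n) \<and>
            real (max_ldim n) \<le> c\<^sub>2 * (real n / ln (real n)))"
proof -
  \<comment> \<open>Since \<open>sqrt n\<close> is of smaller order than \<open>n / ln n\<close>,
    raising the coefficient from 8 to 9 eventually absorbs the other terms.\<close>
  have "\<forall>\<^sub>F n in sequentially. 3 + 2 * sqrt (real n) + 8 * (real n / ln (real n)) \<le> 9 * (real n / ln (real n))"
    by real_asymp
  then obtain N where N: "\<And>n. n \<ge> N \<Longrightarrow>
      3 + 2 * sqrt (real n) + 8 * (real n / ln (real n)) \<le> 9 * (real n / ln (real n))"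
    unfolding eventually_sequentially by blast
  show ?thesis
  proof (intro exI conjI allI impI)
    fix n assume "n \<ge> max N 8"
    then have n: "n \<ge> N" "n \<ge> 8" "n \<ge> 3" by auto
    show "1 / 50 * (real n / ln (real n)) \<le> real (max_ldim n)"
      using max_ldim_lower[OF n(3)] by simp
    show "real (max_ldim n) \<le> 9 * (real n / ln (real n))"
      using max_ldim_upper[OF n(2)] N[OF n(1)] by (rule order_trans)
  qed auto
qed

end
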